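(* For every integer $n \geq 1$ there exist random partitions $\Pi_{n,1}, \Pi_{n,2}, \ldots, \Pi_{n,n}$ of $[n]=\{1,2,\dots,n\}$, defined on a common probability space, such that: (i) for each $1 \leq k \leq n$, $\Pi_{n,k}$ has the distribution of the partition of $[n]$ whose blocks are the cycles of a uniform random permutation of $[n]$ conditioned to have exactly $k$ cycles; equivalently, for every partition $\{A_1,\dots,A_k\}$ of $[n]$ into exactly $k$ blocks, $$\mathbb{P}\left(\Pi_{n,k} = \{A_1,\dots,A_k\}\right) = \frac{\prod_{j=1}^k (|A_j|-1)!}{\sum_{\{A'_1,\dots,A'_k\}} \prod_{j=1}^k (|A'_j|-1)!},$$ where the sum in the denominator is over all partitions $\{A'_1,\dots,A'_k\}$ of $[n]$ into exactly $k$ blocks; (ii) for each $1 \leq k \leq n-1$, with probability 1, the partition $\Pi_{n,k+1}$ is obtained from $\Pi_{n,k}$ by splitting one of the blocks of $\Pi_{n,k}$ into two (non-empty) parts.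
   Context: Blocks of a partition are non-empty. Fixed points of a permutation count as cycles of length 1. *)

theory Defs
  imports "HOL-Probability.Probability" "HOL-Combinatorics.Combinatorics"
begin

definition set_partitions :: "nat \<Rightarrow> nat set set set" where
  "set_partitions n = {P. partition_on {1..n} P}"

definition set_partitions_into :: "nat \<Rightarrow> nat \<Rightarrow> nat set set set" where
  "set_partitions_into n k = {P. partition_on {1..n} P \<and> card P = k}"

(* orbit consists of the images under positive iterates; a fixed point i gives the block {i}. *)
definition cycle_partition :: "nat \<Rightarrow> (nat \<Rightarrow> nat) \<Rightarrow> nat set set" where
  "cycle_partition n \<sigma> = orbit \<sigma> ` {1..n}"

definition uniform_permutation :: "nat \<Rightarrow> (nat \<Rightarrow> nat) pmf" where
  "uniform_permutation n = pmf_of_set {\<sigma>. \<sigma> permutes {1..n}}"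

definition conditioned_cycle_partition :: "nat \<Rightarrow> nat \<Rightarrow> nat set set pmf" where
  "conditioned_cycle_partition n k =
     map_pmf (cycle_partition n)
       (cond_pmf (uniform_permutation n) {\<sigma>. card (cycle_partition n \<sigma>) = k})"

definition cycle_weight :: "nat set set \<Rightarrow> real" where
  "cycle_weight P = (\<Prod>A\<in>P. fact (card A - 1))"

definition splits_one_block :: "'a set set \<Rightarrow> 'a set set \<Rightarrow> bool" where
  "splits_one_block P Q \<longleftrightarrow>
     (\<exists>A\<in>P. \<exists>B C. B \<noteq> {} \<and> C \<noteq> {} \<and> B \<inter> C = {} \<and> B \<union> C = A \<and> Q = (P - {A}) \<union> {B, C})"

end

theory Submission
  imports Defs
begin

text \<open>The chain for \<open>n + 1\<close> is built from the chain \<open>T\<^sub>1, \<dots>, T\<^sub>n\<close> for \<open>n\<close>. Given exactly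
  \<open>k\<close> cycles, the element \<open>n + 1\<close> is a fixed point with probability
  \<open>q k = stirling n (k - 1) / stirling (n + 1) k\<close>, and otherwise it is inserted behind a uniform
  element of \<open>[n]\<close>. Log-concavity of the Stirling numbers makes \<open>q\<close> nondecreasing, so the events
  that \<open>n + 1\<close> is a singleton can be made increasing in \<open>k\<close>: draw \<open>j\<close> with \<open>P(j \<le> k) = q k\<close> and
  \<open>i\<close> uniform in \<open>[n]\<close>, put \<open>n + 1\<close> into the block of \<open>i\<close> in \<open>T\<^sub>k\<close> for \<open>k < j\<close>, and add the block
  \<open>{n + 1}\<close> to \<open>T\<^sub>k\<^sub>-\<^sub>1\<close> for \<open>k \<ge> j\<close>. At the threshold both levels come from the same partition
  \<open>T\<^sub>j\<^sub>-\<^sub>1\<close>, so the step from \<open>j - 1\<close> to \<open>j\<close> splits off \<open>{n + 1}\<close>; every other step inherits its split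
  from the smaller chain.\<close>

subsection \<open>Inserting an element into a partition\<close>

text \<open>The image form avoids choosing the block of \<open>i\<close>, and one map of blocks,
  independent of \<open>P\<close>, acts alike on a partition and on its refinements.\<close>

definition insert_at :: "'a \<Rightarrow> 'a \<Rightarrow> 'a set set \<Rightarrow> 'a set set" where
  "insert_at a i P = (\<lambda>A. if i \<in> A then insert a A else A) ` P"

lemma insert_at_eq:
  assumes "partition_on S Q" "B \<in> Q" "i \<in> B"
  shows "insert_at a i Q = insert (insert a B) (Q - {B})"
proof -
  have "i \<notin> A" if "A \<in> Q - {B}" for A
    using assms that by (auto simp: partition_on_def disjoint_def)
  then have "(\<lambda>A. if i \<in> A then insert a A else A) ` (Q - {B}) = Q - {B}"
    by force
  then have "insert_at a i (insert B (Q - {B})) = insert (insert a B) (Q - {B})"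
    unfolding insert_at_def image_insert using assms(3) by (simp only: if_True)
  then show ?thesis
    using assms(2) by (simp only: insert_Diff)
qed

lemma partition_on_insert_at:
  assumes "partition_on S Q" "a \<notin> S" "i \<in> S"
  shows "partition_on (insert a S) (insert_at a i Q)"
proof -
  obtain B where B: "B \<in> Q" "i \<in> B"
    using assms by (auto simp: partition_on_def)
  show ?thesis
    unfolding insert_at_eq[OF assms(1) B]
    using assms B by (auto simp: partition_on_def disjoint_def)
qed

lemma card_insert_at:
  assumes "partition_on S Q" "a \<notin> S"
  shows "card (insert_at a i Q) = card Q"
  unfolding insert_at_def
proof (rule card_image, rule inj_onI)
  fix A B assume AB: "A \<in> Q" "B \<in> Q"
    "(if i \<in> A then insert a A else A) = (if i \<in> B then insert a B else B)"
  have "a \<notin> A" "a \<notin> B"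
    using AB assms by (auto simp: partition_on_def)
  then show "A = B"
    using AB(3) by (auto split: if_splits)
qed

lemma singleton_notin_insert_at:
  assumes "partition_on S Q" "a \<notin> S" "i \<in> S"
  shows "{a} \<notin> insert_at a i Q"
  using assms by (auto simp: insert_at_def partition_on_def split: if_splits)

text \<open>Deleting \<open>a\<close> from its block inverts the insertion. So a \<open>P\<close> in
  which \<open>a\<close> is no singleton has one source \<open>Q\<close> and
  \<open>card (A - {a})\<close> possible positions \<open>i\<close>; this factor governs both the
  count of permutations and the coupling.\<close>

lemma insert_at_eq_iff:
  assumes Q: "partition_on S Q" and a: "a \<notin> S" and i: "i \<in> S"
    and P: "partition_on (insert a S) P" and A: "A \<in> P" "a \<in> A" "A \<noteq> {a}"
  shows "insert_at a i Q = P \<longleftrightarrow> Q = insert (A - {a}) (P - {A}) \<and> i \<in> A - {a}"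
proof
  assume eq: "insert_at a i Q = P"
  obtain B where B: "B \<in> Q" "i \<in> B"
    using Q i by (auto simp: partition_on_def)
  have P_eq: "P = insert (insert a B) (Q - {B})"
    using insert_at_eq[OF Q B] eq by simp
  have a_notin: "a \<notin> C" if "C \<in> Q" for C
    using that Q a by (auto simp: partition_on_def)
  have "A = insert a B"
    using P_eq A a_notin by auto
  then show "Q = insert (A - {a}) (P - {A}) \<and> i \<in> A - {a}"
    using P_eq a_notin B by auto
next
  assume eq: "Q = insert (A - {a}) (P - {A}) \<and> i \<in> A - {a}"
  \<comment> \<open>Otherwise removing \<open>A - {a}\<close> from \<open>Q\<close> would also
    remove a block of \<open>P - {A}\<close>.\<close>
  have "A - {a} \<notin> P"
  proof
    assume "A - {a} \<in> P"
    moreover have "(A - {a}) \<inter> A \<noteq> {}" "A - {a} \<noteq> A"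
      using A by auto
    ultimately show False
      using P A(1) by (auto simp: partition_on_def disjoint_def)
  qed
  then show "insert_at a i Q = P"
    using insert_at_eq[OF Q, of "A - {a}" i a] eq A by (auto simp: insert_absorb)
qed

lemma partition_on_remove_singleton:
  assumes "partition_on (insert a S) P" "a \<notin> S" "{a} \<in> P"
  shows "partition_on S (P - {{a}})"
proof -
  have "\<Union>(P - {{a}}) = S"
  proof
    show "S \<subseteq> \<Union>(P - {{a}})"
      using assms by (auto simp: partition_on_def)
    have "a \<notin> A" if "A \<in> P" "A \<noteq> {a}" for A
      using disjointD[OF partition_onD2[OF assms(1)] that(1) assms(3) that(2)] by simp
    then have "a \<notin> \<Union>(P - {{a}})"
      by auto
    moreover have "\<Union>(P - {{a}}) \<subseteq> \<Union>P" "\<Union>P = insert a S"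
      using assms(1) by (auto simp: partition_on_def)
    ultimately show "\<Union>(P - {{a}}) \<subseteq> S"
      by (metis subset_insert)
  qed
  then show ?thesis
    using assms(1) by (auto simp: partition_on_def disjoint_def)
qed

lemma partition_on_insert_singleton:
  assumes "partition_on S Q" "a \<notin> S"
  shows "partition_on (insert a S) (insert {a} Q)"
  using assms by (auto simp: partition_on_def disjoint_def)

lemma partition_on_remove:
  assumes "partition_on (insert a S) P" "a \<notin> S" "A \<in> P" "a \<in> A" "A \<noteq> {a}"
  shows "partition_on S (insert (A - {a}) (P - {A}))"
    and "A - {a} \<notin> P"
proof -
  have disj: "B \<inter> A = {}" if "B \<in> P" "B \<noteq> A" for B
    using assms(1,3) that by (auto simp: partition_on_def disjoint_def)
  have "\<Union>(insert (A - {a}) (P - {A})) = \<Union>P - {a}"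
    using disj assms(3,4) by auto
  also have "\<dots> = S"
    using assms(1,2) by (auto simp: partition_on_def)
  finally show "partition_on S (insert (A - {a}) (P - {A}))"
    using assms(1,4,5) disj by (auto simp: partition_on_def disjoint_def)
  show "A - {a} \<notin> P"
    using disj[of "A - {a}"] assms(4,5) by auto
qed

section \<open>Cycle weights under removal of an element\<close>

lemma cycle_weight_insert_singleton:
  assumes "finite Q" "{a} \<notin> Q"
  shows "cycle_weight (insert {a} Q) = cycle_weight Q"
  using assms by (simp add: cycle_weight_def)

text \<open>With m = \<open>card (A - {a})\<close>, the block of \<open>a\<close> contributes m!
  before and (m - 1)! after the removal. Here m > 0 since \<open>A\<close> is not just
  \<open>{a}\<close>, so m! = m (m - 1)!.\<close>

lemma cycle_weight_remove:
  assumes "finite S" "partition_on (insert a S) P" "a \<notin> S" "A \<in> P" "a \<in> A" "A \<noteq> {a}"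
  shows "cycle_weight P = card (A - {a}) * cycle_weight (insert (A - {a}) (P - {A}))"
proof -
  have fin: "finite P" "finite A"
    using assms(1,2,4) by (auto intro: finite_elements finite_subset simp: partition_on_def)
  have pos: "card (A - {a}) > 0"
    unfolding card_gt_0_iff using assms(5,6) fin by blast
  then have "fact (card (A - {a})) = real (card (A - {a})) * fact (card (A - {a}) - 1)"
    by (rule fact_reduce)
  moreover have "card A - 1 = card (A - {a})"
    using assms(5) by simp
  moreover have "cycle_weight P = fact (card A - 1) * (\<Prod>A\<in>P - {A}. fact (card A - 1))"
    unfolding cycle_weight_def using fin assms(4) by (simp add: prod.remove)
  moreover have "cycle_weight (insert (A - {a}) (P - {A}))
      = fact (card (A - {a}) - 1) * (\<Prod>A\<in>P - {A}. fact (card A - 1))"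
    unfolding cycle_weight_def using fin partition_on_remove(2)[OF assms(2-6)]
    by (subst prod.insert) auto
  ultimately show ?thesis
    by simp
qed

section \<open>Splittings under insertion of an element\<close>

lemma splits_one_block_insert_at:
  assumes "splits_one_block P Q" "a \<notin> \<Union>P"
  shows "splits_one_block (insert_at a i P) (insert_at a i Q)"
proof -
  define f where "f = (\<lambda>A. if i \<in> A then insert a A else A)"
  obtain A B C where ABC: "A \<in> P" "B \<noteq> {}" "C \<noteq> {}" "B \<inter> C = {}" "B \<union> C = A"
    "Q = (P - {A}) \<union> {B, C}"
    using assms(1) unfolding splits_one_block_def by blast
  have a: "a \<notin> A" "a \<notin> B" "a \<notin> C"
    using ABC assms(2) by auto
  \<comment> \<open>Blocks of \<open>P\<close> avoid \<open>a\<close>, so removing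
    \<open>f A\<close> from the image of \<open>P\<close> loses the image of \<open>A\<close>
    only.\<close>
  have inj: "D = A" if "D \<in> P" "f D = f A" for D
  proof -
    have "a \<notin> D"
      using assms(2) that by auto
    then show ?thesis
      using that a by (auto simp: f_def split: if_splits)
  qed
  have "f ` Q = (f ` P - {f A}) \<union> {f B, f C}"
    using ABC inj by auto
  \<comment> \<open>Since \<open>B\<close> and \<open>C\<close> are disjoint, \<open>i\<close> lies
    in at most one of them, so at most one part receives \<open>a\<close>.\<close>
  moreover have "f B \<inter> f C = {}" "f B \<union> f C = f A" "f B \<noteq> {}" "f C \<noteq> {}"
    using ABC a by (auto simp: f_def)
  ultimately show ?thesis
    unfolding splits_one_block_def insert_at_def f_def[symmetric] using ABC(1) by blast
qed

lemma splits_one_block_insert_singleton: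
  assumes "splits_one_block P Q" "a \<notin> \<Union>P"
  shows "splits_one_block (insert {a} P) (insert {a} Q)"
proof -
  obtain A B C where ABC: "A \<in> P" "B \<noteq> {}" "C \<noteq> {}" "B \<inter> C = {}" "B \<union> C = A"
    "Q = (P - {A}) \<union> {B, C}"
    using assms(1) unfolding splits_one_block_def by blast
  have "insert {a} Q = (insert {a} P - {A}) \<union> {B, C}"
    using ABC assms(2) by auto
  then show ?thesis
    unfolding splits_one_block_def using ABC by blast
qed

text \<open>The block that received \<open>a\<close> falls apart into its old self, non-empty
  because it contains \<open>i\<close>, and \<open>{a}\<close>.\<close>

lemma splits_one_block_insert_at_singleton:
  assumes "partition_on S Q" "a \<notin> S" "i \<in> S"
  shows "splits_one_block (insert_at a i Q) (insert {a} Q)"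
proof -
  obtain B where B: "B \<in> Q" "i \<in> B"
    using assms by (auto simp: partition_on_def)
  have a: "a \<notin> C" if "C \<in> Q" for C
    using that assms by (auto simp: partition_on_def)
  have "insert {a} Q = (insert_at a i Q - {insert a B}) \<union> {B, {a}}"
    unfolding insert_at_eq[OF assms(1) B] using B a by auto
  moreover have "insert a B \<in> insert_at a i Q"
    unfolding insert_at_eq[OF assms(1) B] by simp
  moreover have "B \<noteq> {}" "B \<inter> {a} = {}" "B \<union> {a} = insert a B"
    using B a by auto
  ultimately show ?thesis
    unfolding splits_one_block_def by (metis insert_not_empty)
qed

subsection \<open>Log-concavity of the Stirling numbers\<close>

text \<open>Allowing all \<open>i \<le> j\<close>, not only adjacent indices, lets the induction
  close. When both sides are expanded by the recurrence, one mixed term is common and cancels; the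
  three other terms are compared one by one.\<close>

lemma stirling_log_concave:
  "i \<le> j \<Longrightarrow> stirling n i * stirling n (Suc j) \<le> stirling n (Suc i) * stirling n j"
proof (induction n arbitrary: i j)
  case (Suc n)
  show ?case
  proof (cases i)
    case (Suc i')
    then obtain j' where j: "j = Suc j'" "i' \<le> j'"
      using \<open>i \<le> j\<close> by (cases j) auto
    let ?s = "stirling n"
    have "?s (Suc i') * ?s (Suc (Suc j')) \<le> ?s (Suc (Suc i')) * ?s (Suc j')"
      and "?s i' * ?s (Suc j') \<le> ?s (Suc i') * ?s j'"
      using Suc.IH j by auto
    \<comment> \<open>For \<open>i' < j'\<close> two instances of the induction hypothesis chain
      through \<open>?s (Suc i') * ?s (Suc j')\<close>; for \<open>i' = j'\<close> both sides
      agree.\<close>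
    moreover have "?s i' * ?s (Suc (Suc j')) \<le> ?s (Suc (Suc i')) * ?s j'"
    proof (cases "i' = j'")
      case False
      then show ?thesis
        using Suc.IH[of i' "Suc j'"] Suc.IH[of "Suc i'" j'] j by simp
    qed (simp add: mult.commute)
    ultimately have "n * n * (?s (Suc i') * ?s (Suc (Suc j')))
        + n * (?s i' * ?s (Suc (Suc j'))) + ?s i' * ?s (Suc j')
      \<le> n * n * (?s (Suc (Suc i')) * ?s (Suc j'))
        + n * (?s (Suc (Suc i')) * ?s j') + ?s (Suc i') * ?s j'"
      by (intro add_mono mult_left_mono) auto
    then show ?thesis
      unfolding j(1) Suc by (simp add: algebra_simps)
  qed simp
qed simp

lemma stirling_pos: "1 \<le> k \<Longrightarrow> k \<le> n \<Longrightarrow> stirling n k > 0"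
proof (induction n arbitrary: k)
  case (Suc n)
  then show ?case
    by (cases k; cases "k = Suc n") (auto simp: Suc_le_eq)
qed simp

text \<open>After cross-multiplying and expanding row \<open>Suc n\<close>, a common product cancels
  and \<open>n\<close> times log-concavity remains. In the coupling this makes the singleton
  probability nondecreasing in the number of blocks.\<close>

lemma stirling_ratio_mono:
  assumes "k < n"
  shows "real (stirling n k) / stirling (Suc n) (Suc k)
      \<le> stirling n (Suc k) / stirling (Suc n) (Suc (Suc k))"
proof -
  have "n * (stirling n k * stirling n (Suc (Suc k))) \<le> n * (stirling n (Suc k) * stirling n (Suc k))"
    using stirling_log_concave[of k "Suc k" n] by simp
  then have "stirling n k * stirling (Suc n) (Suc (Suc k))
      \<le> stirling n (Suc k) * stirling (Suc n) (Suc k)"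
    by (simp add: algebra_simps)
  then have "real (stirling n k) * stirling (Suc n) (Suc (Suc k))
      \<le> stirling n (Suc k) * stirling (Suc n) (Suc k)"
    by (metis of_nat_le_iff of_nat_mult)
  then show ?thesis
    using stirling_pos[of "Suc k" "Suc n"] stirling_pos[of "Suc (Suc k)" "Suc n"] assms
    by (simp add: divide_simps del: stirling.simps)
qed

subsection \<open>Permutations with a prescribed cycle partition\<close>

lemma partition_on_orbits:
  assumes "p permutes S" "finite S"
  shows "partition_on S (orbit p ` S)"
proof (rule partition_onI)
  have "permutation p"
    using assms permutation_permutes by blast
  then show "\<Union>(orbit p ` S) = S"
    using permutation_self_in_orbit permutes_orbit_subset[OF assms(1)] by fastforce
next
  fix A B assume AB: "A \<in> orbit p ` S" "B \<in> orbit p ` S" "A \<noteq> B"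
  show "disjnt A B"
  proof (rule ccontr)
    assume "\<not> disjnt A B"
    then obtain x where x: "x \<in> A" "x \<in> B"
      by (auto simp: disjnt_def)
    have "cyclic_on p A" "cyclic_on p B"
      using AB cyclic_on_orbit[OF assms] by auto
    then have "orbit p x = A" "orbit p x = B"
      using x orbit_cyclic_eq3 by metis+
    then show False
      using AB(3) by simp
  qed
next
  show "{} \<notin> orbit p ` S"
    using orbit_nonempty by (metis imageE)
qed

text \<open>As \<open>p\<close> fixes \<open>a\<close>, the composite sends the predecessor of
  \<open>i\<close> to \<open>a\<close> and \<open>a\<close> to \<open>i\<close>: the cycle of
  \<open>i\<close> makes a detour through \<open>a\<close>, and all other cycles within
  \<open>S\<close> stay as they are.\<close>

lemma orbit_transpose_comp:
  assumes p: "p permutes S" and "finite S" and a: "a \<notin> S" and i: "i \<in> S" and x: "x \<in> S"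
  shows "orbit (Transposition.transpose a i \<circ> p) x = (if i \<in> orbit p x then insert a (orbit p x) else orbit p x)"
proof -
  define q where "q = Transposition.transpose a i \<circ> p"
  have p_in: "p y \<in> S" if "y \<in> S" for y
    using p that by (simp add: permutes_in_image)
  have q_a: "q a = i"
    using p a by (simp add: q_def permutes_not_in)
  have q_in: "q y = (if p y = i then a else p y)" if "y \<in> S" for y
    using p_in[OF that] a by (auto simp: q_def Transposition.transpose_def)
  have in_S: "orbit p x \<subseteq> S"
    using permutes_orbit_subset[OF p x] .
  have "y \<in> orbit q x" if "y \<in> orbit p x" for y
    using that
  proof induction
    case base
    show ?case
      using q_in[OF x] q_a orbit.base[of q x] orbit.step[of a q x] by (auto split: if_splits)
  next
    case (step y)
    have "y \<in> S"
      using step in_S by auto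
    then show ?case
      using q_in q_a orbit.step[OF step.IH] orbit.step[of a q x] by (auto split: if_splits)
  qed
  moreover have "a \<in> orbit q x" if "i \<in> orbit p x"
    using that
  proof cases
    case base
    then show ?thesis
      using q_in[OF x] orbit.base[of q x] by simp
  next
    case (step y)
    then have "y \<in> orbit q x" "y \<in> S"
      using calculation in_S by auto
    then show ?thesis
      using q_in[of y] orbit.step[of y q x] step by simp
  qed
  \<comment> \<open>Strengthened for the induction: reaching \<open>a\<close> records that
    \<open>i\<close> lies in the orbit, so the next step, from \<open>a\<close> to \<open>i\<close>,
    stays inside.\<close>
  moreover have "y \<in> orbit p x \<or> y = a \<and> i \<in> orbit p x" if "y \<in> orbit q x" for y
    using that
  proof induction
    case base
    then show ?case
      using q_in[OF x] orbit.base[of p x] by auto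
  next
    case (step y)
    show ?case
    proof (cases "y = a")
      case True
      then show ?thesis
        using step.IH q_a in_S a by auto
    next
      case False
      then have "y \<in> orbit p x" "y \<in> S"
        using step.IH in_S by auto
      then show ?thesis
        using q_in[of y] orbit.step[of y p x] by auto
    qed
  qed
  ultimately show ?thesis
    unfolding q_def by auto
qed

text \<open>The point \<open>a\<close> lies on the cycle of \<open>i\<close>, so it adds no orbit of
  its own and only the orbits of points of \<open>S\<close> count.\<close>

lemma orbits_transpose_comp:
  assumes p: "p permutes S" and fin: "finite S" and a: "a \<notin> S" and i: "i \<in> S"
  shows "orbit (Transposition.transpose a i \<circ> p) ` insert a S = insert_at a i (orbit p ` S)"
proof -
  define q where "q = Transposition.transpose a i \<circ> p"
  have "q permutes insert a S"
    unfolding q_def using p i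
    by (auto intro!: permutes_compose permutes_swap_id intro: permutes_subset)
  then have "permutation q"
    using fin permutation_permutes by blast
  moreover have "q a = i"
    using p a by (simp add: q_def permutes_not_in)
  ultimately have "orbit q a = orbit q i"
    using permutation_orbit_step by metis
  then have "orbit q ` insert a S = orbit q ` S"
    using i by auto
  also have "\<dots> = insert_at a i (orbit p ` S)"
    unfolding insert_at_def image_image q_def
    using orbit_transpose_comp[OF assms] by (intro image_cong) auto
  finally show ?thesis
    unfolding q_def .
qed

lemma orbits_insert_fixpoint:
  assumes "p permutes S" "a \<notin> S"
  shows "orbit p ` insert a S = insert {a} (orbit p ` S)"
proof -
  have "orbit p a = {a}"
    using assms by (simp add: orbit_eq_singleton_iff permutes_not_in)
  then show ?thesis
    by simp
qed

text \<open>The value of the composite at \<open>a\<close> is \<open>b\<close>, because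
  \<open>p\<close> fixes \<open>a\<close>; once \<open>b\<close> is known, the transposition
  cancels.\<close>

lemma inj_on_transpose_comp:
  assumes "a \<notin> S"
  shows "inj_on (\<lambda>(b, p). Transposition.transpose a b \<circ> p) {(b, p). b \<in> insert a S \<and> p permutes S}"
proof (rule inj_onI, clarify)
  fix b c p q
  assume p: "p permutes S" and q: "q permutes S" and eq: "Transposition.transpose a b \<circ> p = Transposition.transpose a c \<circ> q"
  have "p a = a" "q a = a"
    using p q assms by (simp_all add: permutes_not_in)
  then have "b = c"
    using fun_cong[OF eq, of a] by simp
  moreover have "p = q"
  proof
    fix x
    show "p x = q x"
      using fun_cong[OF eq, of x] \<open>b = c\<close> by (auto dest: transpose_eq_imp_eq)
  qed
  ultimately show "b = c \<and> p = q"
    by simp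
qed

text \<open>Each permutation of \<open>insert a S\<close> is uniquely a transposition of
  \<open>a\<close> and \<open>b\<close> after some \<open>p\<close> permuting \<open>S\<close>:
  \<open>b = a\<close> keeps \<open>a\<close> fixed, \<open>b \<in> S\<close> puts it on the cycle
  of \<open>b\<close>. The count thus obeys the recursion of the weight.\<close>

lemma card_permutations_with_orbits:
  assumes "finite S" "partition_on S P"
  shows "real (card {p. p permutes S \<and> orbit p ` S = P}) = cycle_weight P"
  using assms
proof (induction S arbitrary: P)
  case empty
  then have "{p. p permutes {} \<and> orbit p ` {} = P} = {id}"
    by (auto simp: partition_on_def)
  then show ?case
    using empty by (auto simp: partition_on_def cycle_weight_def)
next
  case (insert a S)
  note a = \<open>a \<notin> S\<close> and fin = \<open>finite S\<close> and P = \<open>partition_on (insert a S) P\<close>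
  define g where "g = (\<lambda>(b, p :: nat \<Rightarrow> nat). Transposition.transpose a b \<circ> p)"
  define F where "F = {(b, p). (b \<in> insert a S \<and> p permutes S) \<and> orbit (g (b, p)) ` insert a S = P}"
  have eq: "{p. p permutes insert a S \<and> orbit p ` insert a S = P} = g ` F"
    using permutes_insert[of a S] by (auto simp: F_def g_def set_eq_iff image_iff)
  have "inj_on g F"
    unfolding g_def F_def by (rule inj_on_subset[OF inj_on_transpose_comp[OF a]]) auto
  then have card_F: "card {p. p permutes insert a S \<and> orbit p ` insert a S = P} = card F"
    unfolding eq by (rule card_image)
  have F_iff: "(b, p) \<in> F \<longleftrightarrow> p permutes S \<and>
      (b = a \<and> insert {a} (orbit p ` S) = P \<or> b \<in> S \<and> insert_at a b (orbit p ` S) = P)" for b p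
  proof -
    have "orbit (g (b, p)) ` insert a S = insert_at a b (orbit p ` S)" if "p permutes S" "b \<in> S"
      unfolding g_def prod.case using orbits_transpose_comp[OF that(1) fin a that(2)] .
    moreover have "orbit (g (a, p)) ` insert a S = insert {a} (orbit p ` S)" if "p permutes S"
      unfolding g_def prod.case transpose_same id_comp
      using orbits_insert_fixpoint[OF that a] .
    ultimately show ?thesis
      unfolding F_def mem_Collect_eq prod.case insert_iff[of b] using a by (cases "b = a") metis+
  qed
  show ?case
  proof (cases "{a} \<in> P")
    case True
    have fixed: "insert {a} (orbit p ` S) = P \<longleftrightarrow> orbit p ` S = P - {{a}}" if "p permutes S" for p
    proof -
      have "{a} \<notin> orbit p ` S"
        using partition_on_orbits[OF that fin] a by (auto simp: partition_on_def)
      then show ?thesis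
        using True by auto
    qed
    have not_fixed: "insert_at a b (orbit p ` S) \<noteq> P" if "p permutes S" "b \<in> S" for b p
      using singleton_notin_insert_at[OF partition_on_orbits[OF that(1) fin] a that(2)] True by auto
    have "(b, p) \<in> F \<longleftrightarrow> b \<in> {a} \<and> p permutes S \<and> orbit p ` S = P - {{a}}" for b p
      unfolding F_iff using fixed[of p] not_fixed[of p b] by (metis singleton_iff)
    \<comment> \<open>The singleton \<open>{a}\<close> forces \<open>b = a\<close>, and
      \<open>p\<close> must realise the remaining blocks.\<close>
    then have "F = {a} \<times> {p. p permutes S \<and> orbit p ` S = P - {{a}}}"
      unfolding set_eq_iff split_paired_all mem_Times_iff by simp
    moreover have "cycle_weight P = cycle_weight (P - {{a}})"
      using cycle_weight_insert_singleton[of "P - {{a}}" a] True finite_elements[OF _ P] fin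
      by (simp add: insert_absorb)
    ultimately show ?thesis
      using card_F insert.IH[OF partition_on_remove_singleton[OF P a True]]
      by (simp add: card_cartesian_product)
  next
    case False
    obtain A where A: "A \<in> P" "a \<in> A"
      using P by (auto simp: partition_on_def)
    then have A': "A \<noteq> {a}"
      using False by auto
    let ?Q = "insert (A - {a}) (P - {A})"
    have A_sub: "A - {a} \<subseteq> S"
      using P A by (auto simp: partition_on_def)
    have "(b, p) \<in> F \<longleftrightarrow> b \<in> A - {a} \<and> p permutes S \<and> orbit p ` S = ?Q" for b p
    proof (cases "p permutes S \<and> b \<in> S")
      case True
      then show ?thesis
        unfolding F_iff
        using insert_at_eq_iff[OF partition_on_orbits[OF _ fin] a _ P A A', of p b] a by metis
    next
      case outside: False
      then have "(b, p) \<notin> F"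
        unfolding F_iff using False by (metis insertI1)
      then show ?thesis
        using outside A_sub by (metis subsetD)
    qed
    \<comment> \<open>Here \<open>b\<close> is any other element of the block of \<open>a\<close>,
      which yields the factor \<open>card (A - {a})\<close>.\<close>
    then have "F = (A - {a}) \<times> {p. p permutes S \<and> orbit p ` S = ?Q}"
      unfolding set_eq_iff split_paired_all mem_Times_iff by simp
    then show ?thesis
      using card_F insert.IH[OF partition_on_remove(1)[OF P a A A']]
        cycle_weight_remove[OF fin P a A A']
      by (simp only: card_cartesian_product of_nat_mult)
  qed
qed

section \<open>Law of the conditioned cycle partition\<close>

lemma finite_set_partitions_into: "finite (set_partitions_into n k)"
  unfolding set_partitions_into_def
  by (auto intro: finite_subset[OF _ finitely_many_partition_on[of "{1..n}"]])

lemma pmf_cycle_partition_uniform: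
  "pmf (map_pmf (cycle_partition n) (uniform_permutation n)) P
    = (if P \<in> set_partitions n then cycle_weight P / fact n else 0)"
proof -
  let ?S = "{\<sigma>. \<sigma> permutes {1..n}}"
  have S: "?S \<noteq> {}" "finite ?S" "card ?S = fact n"
    using permutes_id[of "{1..n}"] finite_permutations[of "{1..n}"]
      card_permutations[of "{1..n}" n]
    by (blast, simp_all)
  have "pmf (map_pmf (cycle_partition n) (uniform_permutation n)) P
      = real (card (?S \<inter> cycle_partition n -` {P})) / fact n"
    unfolding pmf_map uniform_permutation_def using S by (simp add: measure_pmf_of_set)
  moreover have "?S \<inter> cycle_partition n -` {P} = {p. p permutes {1..n} \<and> orbit p ` {1..n} = P}"
    by (auto simp: cycle_partition_def)
  moreover have "{p. p permutes {1..n} \<and> orbit p ` {1..n} = P} = {}" if "P \<notin> set_partitions n"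
    using that partition_on_orbits[of _ "{1..n}"] by (auto simp: set_partitions_def)
  moreover have "real (card {p. p permutes {1..n} \<and> orbit p ` {1..n} = P}) = cycle_weight P"
    if "P \<in> set_partitions n"
    using that by (intro card_permutations_with_orbits) (simp_all add: set_partitions_def)
  ultimately show ?thesis
    by (cases "P \<in> set_partitions n") (simp_all only: if_True if_False simp_thms card.empty of_nat_0 div_0)
qed

lemma cycle_weight_pos: "cycle_weight P > 0"
  unfolding cycle_weight_def by (intro prod_pos) auto

text \<open>The event depends on the cycle partition only, so conditioning may take place after
  passing to it; \<open>fact n\<close> then cancels. Non-emptiness gives the event positive
  probability.\<close>

lemma pmf_conditioned_cycle_partition:
  assumes "set_partitions_into n k \<noteq> {}"
  shows "pmf (conditioned_cycle_partition n k) P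
    = (if P \<in> set_partitions_into n k
       then cycle_weight P / (\<Sum>Q\<in>set_partitions_into n k. cycle_weight Q) else 0)"
proof -
  define p where "p = map_pmf (cycle_partition n) (uniform_permutation n)"
  define B where "B = {Q :: nat set set. card Q = k}"
  have pmf_p: "pmf p Q = (if Q \<in> set_partitions n then cycle_weight Q / fact n else 0)" for Q
    unfolding p_def by (rule pmf_cycle_partition_uniform)
  have set_p: "set_pmf p = set_partitions n"
    using cycle_weight_pos by (auto simp: set_pmf_eq pmf_p less_imp_neq[symmetric])
  have B: "B \<inter> set_pmf p = set_partitions_into n k"
    by (auto simp: set_p B_def set_partitions_def set_partitions_into_def)
  then have ne: "set_pmf p \<inter> B \<noteq> {}"
    using assms by auto
  then have "set_pmf (uniform_permutation n) \<inter> cycle_partition n -` B \<noteq> {}"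
    by (auto simp: p_def)
  then have "conditioned_cycle_partition n k = cond_pmf p B"
    unfolding conditioned_cycle_partition_def p_def B_def
    by (subst cond_map_pmf) (auto simp: vimage_def)
  moreover have "measure_pmf.prob p B = (\<Sum>Q\<in>set_partitions_into n k. cycle_weight Q) / fact n"
  proof -
    have "measure_pmf.prob p B = measure_pmf.prob p (set_partitions_into n k)"
      by (metis B measure_Int_set_pmf)
    also have "\<dots> = (\<Sum>Q\<in>set_partitions_into n k. pmf p Q)"
      by (rule measure_measure_pmf_finite) (rule finite_set_partitions_into)
    also have "\<dots> = (\<Sum>Q\<in>set_partitions_into n k. cycle_weight Q / fact n)"
      by (rule sum.cong) (auto simp: pmf_p set_partitions_def set_partitions_into_def)
    finally show ?thesis
      by (simp add: sum_divide_distrib)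
  qed
  moreover have "P \<in> set_partitions_into n k \<longleftrightarrow> P \<in> set_partitions n \<and> P \<in> B"
    using B set_p by auto
  ultimately show ?thesis
    by (simp add: pmf_cond[OF ne] pmf_p)
qed

subsection \<open>The coupling\<close>

text \<open>Read \<open>q\<close> as a distribution function: its increments, nonnegative by
  monotonicity, are the point masses, and their partial sums telescope.\<close>

lemma threshold_pmf:
  fixes q :: "nat \<Rightarrow> real"
  assumes "a \<le> b" and mono: "\<And>k. a \<le> k \<Longrightarrow> k < b \<Longrightarrow> q k \<le> q (Suc k)"
    and q: "q a = 0" "q b = 1"
  obtains J where "set_pmf J \<subseteq> {a<..b}"
    and "\<And>k. a \<le> k \<Longrightarrow> k \<le> b \<Longrightarrow> measure_pmf.prob J {..k} = q k"
proof -
  define f where "f = (\<lambda>j. if j \<in> {a<..b} then q j - q (j - 1) else 0)"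
  have f_nonneg: "f j \<ge> 0" for j
    using mono[of "j - 1"] by (auto simp: f_def)
  have sum_f: "(\<Sum>j\<le>k. f j) = q k" if "a \<le> k" "k \<le> b" for k
    using that
  proof (induction k rule: dec_induct)
    case base
    have "(\<Sum>j\<le>a. f j) = 0"
      by (rule sum.neutral) (simp add: f_def)
    then show ?case
      using q by simp
  next
    case (step k)
    then show ?case
      by (simp add: f_def)
  qed
  have "(\<integral>\<^sup>+ j. ennreal (f j) \<partial>count_space UNIV) = (\<Sum>j\<le>b. ennreal (f j))"
    by (rule nn_integral_count_space') (auto simp: f_def)
  also have "\<dots> = ennreal (\<Sum>j\<le>b. f j)"
    using f_nonneg by simp
  also have "\<dots> = 1"
    using sum_f[of b] assms by simp
  finally have total: "(\<integral>\<^sup>+ j. ennreal (f j) \<partial>count_space UNIV) = 1" .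
  have pmf_J: "pmf (embed_pmf f) j = f j" for j
    by (rule pmf_embed_pmf[OF f_nonneg total])
  show thesis
  proof
    show "set_pmf (embed_pmf f) \<subseteq> {a<..b}"
      unfolding set_pmf_eq pmf_J by (auto simp: f_def split: if_splits)
    show "measure_pmf.prob (embed_pmf f) {..k} = q k" if "a \<le> k" "k \<le> b" for k
      using sum_f[OF that] by (simp add: measure_measure_pmf_finite pmf_J)
  qed
qed

text \<open>Cutting both factors down to their supports makes them countable, as the product rule
  applied here asks.\<close>

lemma prob_pair_pmf_Times:
  "measure_pmf.prob (pair_pmf M N) (A \<times> B) = measure_pmf.prob M A * measure_pmf.prob N B"
proof -
  have "measure_pmf.prob (pair_pmf M N) (A \<times> B)
      = measure_pmf.prob (pair_pmf M N) (A \<times> B \<inter> set_pmf (pair_pmf M N))"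
    by (simp only: measure_Int_set_pmf)
  also have "A \<times> B \<inter> set_pmf (pair_pmf M N) = (A \<inter> set_pmf M) \<times> (B \<inter> set_pmf N)"
    by auto
  also have "measure_pmf.prob (pair_pmf M N) \<dots>
      = measure_pmf.prob M (A \<inter> set_pmf M) * measure_pmf.prob N (B \<inter> set_pmf N)"
    by (rule measure_pmf_prob_product) (auto intro: countable_subset[OF _ countable_set_pmf])
  finally show ?thesis
    by (simp only: measure_Int_set_pmf)
qed

lemma prob_pmf_cong:
  assumes "\<And>x. x \<in> set_pmf p \<Longrightarrow> x \<in> A \<longleftrightarrow> x \<in> B"
  shows "measure_pmf.prob p A = measure_pmf.prob p B"
  using assms by (intro measure_pmf.finite_measure_eq_AE) (auto simp: AE_measure_pmf_iff)

text \<open>Product form matters only on the supports; for the events about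
  \<open>extend_chain\<close> it is established only there.\<close>

lemma prob_pair_pmf_rectangle:
  assumes "\<And>x y z. x \<in> set_pmf p \<Longrightarrow> y \<in> set_pmf q \<Longrightarrow> z \<in> set_pmf r \<Longrightarrow>
    P x y z \<longleftrightarrow> x \<in> A \<and> y \<in> B \<and> z \<in> C"
  shows "measure_pmf.prob (pair_pmf p (pair_pmf q r)) {(x, y, z). P x y z}
    = measure_pmf.prob p A * (measure_pmf.prob q B * measure_pmf.prob r C)"
proof -
  have "measure_pmf.prob (pair_pmf p (pair_pmf q r)) {(x, y, z). P x y z}
      = measure_pmf.prob (pair_pmf p (pair_pmf q r)) (A \<times> (B \<times> C))"
    using assms by (intro prob_pmf_cong) auto
  then show ?thesis
    by (simp only: prob_pair_pmf_Times)
qed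

lemma card_partition_on_le:
  assumes "partition_on S Q" "finite S"
  shows "card Q \<le> card S"
proof -
  have "finite A \<and> card A \<ge> 1" if "A \<in> Q" for A
  proof -
    have "A \<subseteq> S" "A \<noteq> {}"
      using that assms(1) by (auto simp: partition_on_def)
    then show ?thesis
      using assms(2) by (auto simp: Suc_le_eq card_gt_0_iff intro: finite_subset)
  qed
  moreover from this have "card (\<Union>Q) = (\<Sum>A\<in>Q. card A)"
    using assms by (intro card_Union_disjoint) (auto simp: partition_on_def)
  ultimately have "(\<Sum>A\<in>Q. 1) \<le> card (\<Union>Q)"
    by (simp only:) (intro sum_mono, simp)
  then show ?thesis
    using assms(1) by (simp add: partition_on_def)
qed

section \<open>Chains of successive splittings and their extension\<close>

definition fragmentation_chain :: "nat \<Rightarrow> (nat \<Rightarrow> nat set set) \<Rightarrow> bool" where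
  "fragmentation_chain n \<omega> \<longleftrightarrow> (\<forall>k\<in>{1..n}. \<omega> k \<in> set_partitions_into n k) \<and>
     (\<forall>k\<in>{1..<n}. splits_one_block (\<omega> k) (\<omega> (Suc k)))"

definition extend_chain ::
    "nat \<Rightarrow> nat \<Rightarrow> nat \<Rightarrow> (nat \<Rightarrow> nat set set) \<Rightarrow> nat \<Rightarrow> nat set set" where
  "extend_chain n j i \<omega> k =
     (if k < j then insert_at (Suc n) i (\<omega> k) else insert {Suc n} (\<omega> (k - 1)))"

text \<open>By \<open>1 < j \<le> Suc n\<close>, every index at which the smaller chain is read lies
  in \<open>{1..n}\<close>: \<open>k\<close> when \<open>k < j\<close>, and \<open>k - 1\<close>
  when \<open>j \<le> k\<close>.\<close>

lemma fragmentation_chain_extend: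
  assumes \<omega>: "fragmentation_chain n \<omega>" and j: "j \<in> {1<..Suc n}" and i: "i \<in> {1..n}"
  shows "fragmentation_chain (Suc n) (extend_chain n j i \<omega>)"
proof -
  have S: "{1..Suc n} = insert (Suc n) {1..n}" and notin: "Suc n \<notin> {1..n}"
    by auto
  have part: "partition_on {1..n} (\<omega> k)" "card (\<omega> k) = k" if "k \<in> {1..n}" for k
    using \<omega> that by (auto simp: fragmentation_chain_def set_partitions_into_def)
  then have fresh: "Suc n \<notin> \<Union>(\<omega> k)" if "k \<in> {1..n}" for k
    using that notin by (metis partition_onD1)
  have split: "splits_one_block (\<omega> k) (\<omega> (Suc k))" if "k \<in> {1..<n}" for k
    using \<omega> that by (auto simp: fragmentation_chain_def)
  have "extend_chain n j i \<omega> k \<in> set_partitions_into (Suc n) k" if k: "k \<in> {1..Suc n}" for k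
  proof (cases "k < j")
    case True
    then have "k \<in> {1..n}"
      using k j by auto
    then show ?thesis
      using True partition_on_insert_at[OF part(1) notin i] card_insert_at[OF part(1) notin] part(2)
      unfolding set_partitions_into_def extend_chain_def S by auto
  next
    case False
    then have k': "k - 1 \<in> {1..n}"
      using k j by auto
    have "{Suc n} \<notin> \<omega> (k - 1)" "finite (\<omega> (k - 1))"
      using fresh[OF k'] finite_elements[OF _ part(1)[OF k']] by auto
    then have "card (insert {Suc n} (\<omega> (k - 1))) = k"
      using part(2)[OF k'] k by simp
    then show ?thesis
      using False partition_on_insert_singleton[OF part(1)[OF k'] notin]
      unfolding set_partitions_into_def extend_chain_def S by simp
  qed
  moreover have "splits_one_block (extend_chain n j i \<omega> k) (extend_chain n j i \<omega> (Suc k))"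
    if k: "k \<in> {1..<Suc n}" for k
  proof -
    consider "Suc k < j" | "Suc k = j" | "j \<le> k"
      by linarith
    then show ?thesis
    proof cases
      case 1
      then have "k \<in> {1..<n}"
        using k j by auto
      then show ?thesis
        using 1 splits_one_block_insert_at[OF split fresh] by (simp add: extend_chain_def)
    next
      case 2
      then show ?thesis
        using k splits_one_block_insert_at_singleton[OF part(1) notin i]
        by (auto simp: extend_chain_def)
    next
      case 3
      then have "k - 1 \<in> {1..<n}" "Suc (k - 1) = k"
        using k j by auto
      then show ?thesis
        using 3 splits_one_block_insert_singleton[OF split[of "k - 1"] fresh]
        by (simp add: extend_chain_def)
    qed
  qed
  ultimately show ?thesis
    by (simp add: fragmentation_chain_def)
qed

text \<open>The law carries the denominator \<open>stirling n k\<close>, whose recurrence fits the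
  extension step; that it equals the total weight is read off later from the total mass.\<close>

lemma ex_pmf_fragmentation_chain:
  assumes "n \<ge> 1"
  shows "\<exists>D. (\<forall>\<omega>\<in>set_pmf D. fragmentation_chain n \<omega>) \<and>
    (\<forall>k\<in>{1..n}. \<forall>P\<in>set_partitions_into n k.
       measure_pmf.prob D {\<omega>. \<omega> k = P} = cycle_weight P / stirling n k)"
  using assms
proof (induction n rule: nat_induct_at_least)
  case base
  have single: "P = {{1}}" if "partition_on {1} P" for P :: "nat set set"
  proof -
    have U: "\<Union>P = {1}" "{} \<notin> P"
      using that by (auto simp: partition_on_def)
    have "A = {1}" if "A \<in> P" for A
    proof -
      have "A \<subseteq> {1}" "A \<noteq> {}"
        using Union_upper[OF that] U that by (simp, metis)
      then show ?thesis
        by (simp only: subset_singleton_iff simp_thms)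
    qed
    then have "P \<subseteq> {{1}}"
      by (simp add: subset_iff)
    moreover have "P \<noteq> {}"
      using U by (metis Union_empty insert_not_empty)
    ultimately show ?thesis
      by (simp only: subset_singleton_iff simp_thms)
  qed
  have "P \<in> set_partitions_into 1 1 \<longleftrightarrow> P = {{1}}" for P
  proof
    assume "P \<in> set_partitions_into 1 1"
    then show "P = {{1}}"
      unfolding set_partitions_into_def atLeastAtMost_singleton by (intro single) simp
  qed (simp add: set_partitions_into_def partition_on_def)
  then have into_1: "set_partitions_into 1 1 = {{{1}}}"
    by (intro set_eqI) (simp only: singleton_iff)
  have "fragmentation_chain 1 (\<lambda>_. {{1}})"
    unfolding fragmentation_chain_def atLeastAtMost_singleton using into_1 by simp
  moreover have "measure_pmf.prob (return_pmf (\<lambda>_. {{1}})) {\<omega>. \<omega> 1 = {{1}}}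
      = cycle_weight {{1}} / stirling 1 1"
    by (simp add: cycle_weight_def)
  ultimately show ?case
    unfolding atLeastAtMost_singleton
    by (intro exI[of _ "return_pmf (\<lambda>_. {{1}})"]) (simp add: into_1 del: One_nat_def)
next
  case (Suc n)
  let ?s = stirling and ?N = "Suc n"
  have S: "{1..Suc n} = insert (Suc n) {1..n}" and notin: "Suc n \<notin> {1..n}"
    by auto
  from Suc.IH obtain D where D: "\<And>\<omega>. \<omega> \<in> set_pmf D \<Longrightarrow> fragmentation_chain n \<omega>"
    and prob_D: "\<And>k P. k \<in> {1..n} \<Longrightarrow> P \<in> set_partitions_into n k \<Longrightarrow>
      measure_pmf.prob D {\<omega>. \<omega> k = P} = cycle_weight P / ?s n k"
    by blast
  define q where "q = (\<lambda>k. real (?s n (k - 1)) / ?s ?N k)"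
  have "q k \<le> q (Suc k)" if "1 \<le> k" "k < ?N" for k
    using stirling_ratio_mono[of "k - 1" n] that by (simp add: q_def del: stirling.simps)
  \<comment> \<open>\<open>stirling n 0\<close> vanishes for \<open>n \<ge> 1\<close>, and diagonal
    entries are 1: the new element is never a singleton when there is one block, and always when
    there are \<open>Suc n\<close>.\<close>
  moreover have "q 1 = 0" "q ?N = 1"
    using Suc.hyps by (simp_all add: q_def del: stirling.simps)
  ultimately obtain J where J: "set_pmf J \<subseteq> {1<..?N}"
    and prob_J: "\<And>k. 1 \<le> k \<Longrightarrow> k \<le> ?N \<Longrightarrow> measure_pmf.prob J {..k} = q k"
    using threshold_pmf[of 1 ?N q] by auto
  define U where "U = pmf_of_set {1..n}"
  have U: "set_pmf U = {1..n}"
    using Suc.hyps by (simp add: U_def)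
  \<comment> \<open>Independence of chain, threshold and position turns each event below into a
    product.\<close>
  define E where "E = map_pmf (\<lambda>(\<omega>, j, i). extend_chain n j i \<omega>) (pair_pmf D (pair_pmf J U))"
  have "fragmentation_chain ?N \<omega>" if \<omega>_in: "\<omega> \<in> set_pmf E" for \<omega>
  proof -
    obtain \<omega>' j i where "\<omega>' \<in> set_pmf D" "j \<in> set_pmf J" "i \<in> set_pmf U"
      and \<omega>: "\<omega> = extend_chain n j i \<omega>'"
      using \<omega>_in by (auto simp: E_def)
    then show ?thesis
      unfolding \<omega> using J by (intro fragmentation_chain_extend D) (auto simp only: U)
  qed
  moreover have "measure_pmf.prob E {\<omega>. \<omega> k = P} = cycle_weight P / ?s ?N k"
    if k: "k \<in> {1..?N}" and "P \<in> set_partitions_into ?N k" for k P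
  proof -
    have P: "partition_on (insert ?N {1..n}) P" and card_P: "card P = k"
      using that unfolding set_partitions_into_def S by auto
    have fin_P: "finite P"
      using finite_elements[OF _ P] by simp
    have s_pos: "?s ?N k > 0"
      using k by (intro stirling_pos) auto
    have E_eq: "measure_pmf.prob E {\<omega>. \<omega> k = P} = measure_pmf.prob (pair_pmf D (pair_pmf J U))
        {(\<omega>, j, i). extend_chain n j i \<omega> k = P}"
      by (auto simp: E_def intro!: arg_cong[where f = "measure_pmf.prob _"])
    have part: "partition_on {1..n} (\<omega> l)" if "\<omega> \<in> set_pmf D" "l \<in> {1..n}" for \<omega> l
      using D[OF that(1)] that(2) by (auto simp: fragmentation_chain_def set_partitions_into_def)
    show ?thesis
    proof (cases "{?N} \<in> P")
      case True
      let ?Q = "P - {{?N}}"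
      have Q: "partition_on {1..n} ?Q"
        by (rule partition_on_remove_singleton[OF P notin True])
      have card_Q: "card ?Q = k - 1"
        using True card_P by simp
      \<comment> \<open>As \<open>n \<ge> 1\<close>, there is a further block; hence
        \<open>k \<ge> 2\<close> and the smaller chain is defined at \<open>k - 1\<close>.\<close>
      have "?Q \<noteq> {}"
        using Q Suc.hyps by (auto simp: partition_on_def)
      then have "card ?Q > 0"
        using fin_P by (simp only: card_gt_0_iff finite_Diff simp_thms)
      then have k': "k - 1 \<in> {1..n}"
        using card_Q k by auto
      \<comment> \<open>Insertion never creates the block \<open>{?N}\<close>, so the threshold must
        have been reached, and the position \<open>i\<close> is free.\<close>
      have "extend_chain n j i \<omega> k = P \<longleftrightarrow> \<omega> \<in> {\<omega>. \<omega> (k - 1) = ?Q} \<and> j \<in> {..k} \<and> i \<in> UNIV"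
        if "\<omega> \<in> set_pmf D" "j \<in> {1<..?N}" "i \<in> {1..n}" for \<omega> j i
      proof (cases "k < j")
        case less: True
        then have "partition_on {1..n} (\<omega> k)"
          using part that k by auto
        then show ?thesis
          using singleton_notin_insert_at[OF _ notin that(3)] True less
          by (auto simp: extend_chain_def)
      next
        case ge: False
        have "{?N} \<notin> \<omega> (k - 1)"
          using partition_onD1[OF part[OF that(1) k']] notin by (metis UnionI singletonI)
        then show ?thesis
          using True ge by (auto simp: extend_chain_def)
      qed
      then have "measure_pmf.prob E {\<omega>. \<omega> k = P}
          = measure_pmf.prob D {\<omega>. \<omega> (k - 1) = ?Q} *
            (measure_pmf.prob J {..k} * measure_pmf.prob U UNIV)"
        unfolding E_eq using J by (intro prob_pair_pmf_rectangle) (simp only: U subset_iff)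
      also have "\<dots> = cycle_weight ?Q / ?s n (k - 1) * q k"
        using prob_D[OF k', of ?Q] prob_J[of k] Q card_Q k by (simp add: set_partitions_into_def)
      also have "\<dots> = cycle_weight ?Q / ?s ?N k"
        using stirling_pos[of "k - 1" n] k' by (simp add: q_def del: stirling.simps)
      also have "cycle_weight ?Q = cycle_weight P"
        using cycle_weight_insert_singleton[of ?Q ?N] True fin_P by (simp add: insert_absorb)
      finally show ?thesis .
    next
      case False
      obtain A where A: "A \<in> P" "?N \<in> A"
        using P by (auto simp: partition_on_def)
      then have A': "A \<noteq> {?N}"
        using False by auto
      let ?Q = "insert (A - {?N}) (P - {A})"
      have Q: "partition_on {1..n} ?Q"
        by (rule partition_on_remove(1)[OF P notin A A'])
      have card_Q: "card ?Q = k"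
        using partition_on_remove(2)[OF P notin A A'] fin_P A card_P
        by (metis Diff_iff card.remove card_insert_disjoint finite_Diff)
      \<comment> \<open>\<open>?Q\<close> has \<open>k\<close> blocks on \<open>n\<close> points,
        which rules out \<open>k = Suc n\<close>.\<close>
      have k': "k \<in> {1..n}"
        using card_partition_on_le[OF Q] card_Q k by simp
      have A_sub: "A - {?N} \<subseteq> {1..n}"
        using P A by (auto simp: partition_on_def)
      \<comment> \<open>From the threshold on \<open>{?N}\<close> would be a block, so
        \<open>j > k\<close>; then \<open>?Q\<close> is the only source and \<open>i\<close> any
        companion of \<open>?N\<close>.\<close>
      have "extend_chain n j i \<omega> k = P \<longleftrightarrow>
          \<omega> \<in> {\<omega>. \<omega> k = ?Q} \<and> j \<in> {k<..} \<and> i \<in> A - {?N}"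
        if "\<omega> \<in> set_pmf D" "i \<in> {1..n}" for \<omega> j i
      proof (cases "k < j")
        case True
        then show ?thesis
          using insert_at_eq_iff[OF part[OF that(1) k'] notin that(2) P A A']
          by (simp only: extend_chain_def if_True simp_thms mem_Collect_eq greaterThan_iff)
      next
        case ge: False
        then have "{?N} \<in> extend_chain n j i \<omega> k"
          by (simp add: extend_chain_def)
        then show ?thesis
          using False ge by (metis greaterThan_iff)
      qed
      then have "measure_pmf.prob E {\<omega>. \<omega> k = P}
          = measure_pmf.prob D {\<omega>. \<omega> k = ?Q} *
            (measure_pmf.prob J {k<..} * measure_pmf.prob U (A - {?N}))"
        unfolding E_eq by (intro prob_pair_pmf_rectangle) (simp only: U)
      also have "measure_pmf.prob D {\<omega>. \<omega> k = ?Q} = cycle_weight ?Q / ?s n k"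
        using Q card_Q by (intro prob_D[OF k']) (simp add: set_partitions_into_def)
      also have "measure_pmf.prob U (A - {?N}) = card (A - {?N}) / n"
        using A_sub Suc.hyps by (simp add: U_def measure_pmf_of_set Int_absorb1)
      also have "measure_pmf.prob J {k<..} = 1 - q k"
      proof -
        have "{k<..} = space (measure_pmf J) - {..k}"
          by auto
        then show ?thesis
          using measure_pmf.prob_compl[of "{..k}" J] prob_J[of k] k by simp
      qed
      \<comment> \<open>The recurrence splits \<open>?s ?N k\<close> into a singleton part and an
        insertion part.\<close>
      also have "1 - q k = n * ?s n k / ?s ?N k"
      proof -
        have "real (?s ?N k) = n * ?s n k + ?s n (k - 1)"
          using k by (cases k) auto
        then show ?thesis
          using s_pos by (simp add: q_def field_simps del: stirling.simps)
      qed
      \<comment> \<open>The \<open>n\<close> possible positions cancel against the uniform choice of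
        \<open>i\<close>; what is left is exactly the factor between the two weights.\<close>
      also have "cycle_weight ?Q / ?s n k * (n * ?s n k / ?s ?N k * (card (A - {?N}) / n))
          = card (A - {?N}) * cycle_weight ?Q / ?s ?N k"
        using stirling_pos[of k n] k' by (simp del: stirling.simps)
      also have "card (A - {?N}) * cycle_weight ?Q = cycle_weight P"
        using cycle_weight_remove[OF _ P notin A A'] by simp
      finally show ?thesis .
    qed
  qed
  ultimately show ?case
    by blast
qed

section \<open>Random partitions from the chain\<close>

theorem mainTheorem1:
  fixes n :: nat
  assumes "n \<ge> 1"
  shows "\<exists>(M :: (nat \<Rightarrow> nat set set) measure)
          (X :: nat \<Rightarrow> (nat \<Rightarrow> nat set set) \<Rightarrow> nat set set).
    prob_space M \<and>
    (\<forall>k\<in>{1..n}. X k \<in> measurable M (count_space (set_partitions n))) \<and>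
    (\<forall>k\<in>{1..n}.
       distr M (count_space UNIV) (X k) = measure_pmf (conditioned_cycle_partition n k) \<and>
       (\<forall>P\<in>set_partitions_into n k.
          measure M {\<omega> \<in> space M. X k \<omega> = P}
            = cycle_weight P / (\<Sum>Q\<in>set_partitions_into n k. cycle_weight Q))) \<and>
    (\<forall>k\<in>{1..n-1}. AE \<omega> in M. splits_one_block (X k \<omega>) (X (k + 1) \<omega>))"
proof -
  obtain D where D: "\<And>\<omega>. \<omega> \<in> set_pmf D \<Longrightarrow> fragmentation_chain n \<omega>"
    and prob_D: "\<And>k P. k \<in> {1..n} \<Longrightarrow> P \<in> set_partitions_into n k \<Longrightarrow>
      measure_pmf.prob D {\<omega>. \<omega> k = P} = cycle_weight P / stirling n k"
    using ex_pmf_fragmentation_chain[OF assms] by blast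
  \<comment> \<open>A coordinate of the chain, with the one-block partition as default, so that
    \<open>X k\<close> takes values in \<open>set_partitions n\<close> everywhere, as measurability
    requires. For \<open>k\<close> in \<open>{1..n}\<close> the default has probability 0.\<close>
  define X where "X = (\<lambda>k \<omega> :: nat \<Rightarrow> nat set set.
    if \<omega> k \<in> set_partitions n then \<omega> k else {{1..n}})"
  have D_in: "\<omega> k \<in> set_partitions_into n k" if "\<omega> \<in> set_pmf D" "k \<in> {1..n}" for \<omega> k
    using D[OF that(1)] that(2) by (auto simp: fragmentation_chain_def)
  have into_sub: "set_partitions_into n k \<subseteq> set_partitions n" for k
    by (auto simp: set_partitions_def set_partitions_into_def)
  have X_D: "X k \<omega> = \<omega> k" if "\<omega> \<in> set_pmf D" "k \<in> {1..n}" for \<omega> k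
    using D_in[OF that] into_sub by (auto simp: X_def)
  have ne: "set_partitions_into n k \<noteq> {}" if "k \<in> {1..n}" for k
    using D_in[OF _ that] set_pmf_not_empty[of D] by blast
  have prob_stirling: "measure_pmf.prob D {\<omega>. X k \<omega> = P} = cycle_weight P / stirling n k"
    if "k \<in> {1..n}" "P \<in> set_partitions_into n k" for k P
    using prob_D[OF that] prob_pmf_cong[of D "{\<omega>. X k \<omega> = P}" "{\<omega>. \<omega> k = P}"] X_D that(1) by simp
  have pmf_X: "pmf (map_pmf (X k) D) P = measure_pmf.prob D {\<omega>. X k \<omega> = P}" for k P
    by (simp add: pmf_map vimage_def)
  have set_X: "set_pmf (map_pmf (X k) D) \<subseteq> set_partitions_into n k" if "k \<in> {1..n}" for k
    using X_D D_in that by auto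
  \<comment> \<open>The point masses sum to 1, which identifies the total weight with the Stirling
    number without a separate count.\<close>
  have total: "(\<Sum>Q\<in>set_partitions_into n k. cycle_weight Q) = stirling n k" if "k \<in> {1..n}" for k
  proof -
    have "1 = (\<Sum>Q\<in>set_partitions_into n k. pmf (map_pmf (X k) D) Q)"
      using sum_pmf_eq_1[OF finite_set_partitions_into set_X[OF that]] by simp
    also have "\<dots> = (\<Sum>Q\<in>set_partitions_into n k. cycle_weight Q / stirling n k)"
      using prob_stirling[OF that] by (intro sum.cong) (simp_all only: pmf_X)
    also have "\<dots> = (\<Sum>Q\<in>set_partitions_into n k. cycle_weight Q) / stirling n k"
      by (simp add: sum_divide_distrib)
    finally show ?thesis
      using stirling_pos[of k n] that by (simp add: field_simps)
  qed
  have prob_X: "measure_pmf.prob D {\<omega>. X k \<omega> = P}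
      = cycle_weight P / (\<Sum>Q\<in>set_partitions_into n k. cycle_weight Q)"
    if "k \<in> {1..n}" "P \<in> set_partitions_into n k" for k P
    using prob_stirling[OF that] total[OF that(1)] by simp
  have "map_pmf (X k) D = conditioned_cycle_partition n k" if "k \<in> {1..n}" for k
  proof (rule pmf_eqI)
    fix P
    show "pmf (map_pmf (X k) D) P = pmf (conditioned_cycle_partition n k) P"
    proof (cases "P \<in> set_partitions_into n k")
      case True
      then show ?thesis
        unfolding pmf_conditioned_cycle_partition[OF ne[OF that]] pmf_X
        using prob_X[OF that] by simp
    next
      case False
      then have "P \<notin> set_pmf (map_pmf (X k) D)"
        using set_X[OF that] by blast
      then show ?thesis
        unfolding pmf_conditioned_cycle_partition[OF ne[OF that]] using False
        by (simp only: set_pmf_iff if_False simp_thms)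
    qed
  qed
  then have "distr D (count_space UNIV) (X k) = measure_pmf (conditioned_cycle_partition n k)"
    if "k \<in> {1..n}" for k
    using that by (metis map_pmf_rep_eq)
  moreover have "X k \<in> measurable D (count_space (set_partitions n))" for k
  proof -
    have "{{1..n}} \<in> set_partitions n"
      using assms by (simp add: set_partitions_def partition_on_def)
    then show ?thesis
      by (auto simp: X_def)
  qed
  moreover have "AE \<omega> in D. splits_one_block (X k \<omega>) (X (k + 1) \<omega>)" if "k \<in> {1..n-1}" for k
  proof (rule AE_pmfI)
    fix \<omega> assume \<omega>: "\<omega> \<in> set_pmf D"
    have "k \<in> {1..n}" "k + 1 \<in> {1..n}" "k \<in> {1..<n}"
      using that assms by auto
    then show "splits_one_block (X k \<omega>) (X (k + 1) \<omega>)"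
      using X_D[OF \<omega>] D[OF \<omega>] by (simp add: fragmentation_chain_def)
  qed
  ultimately show ?thesis
    using prob_X measure_pmf.prob_space_axioms[of D]
    by (intro exI[of _ "measure_pmf D"] exI[of _ X]) simp
qed

end
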